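(* Let $n$ and $m$ be positive integers, let $\zeta$ be a primitive $m$th root of unity, and write $n=mk+i$ with $0\le i<m$. Then $$A_n(\zeta,r) = A_i(\zeta,r)\,\frac{(r)_n}{(r)_i\,(1-r^m)^k}.$$
   Context: For $n\ge 0$, $A_n(t,r):=\sum_{\pi\in S_n} t^{\ell(\pi)} r^{{\rm maj}(\pi)}$, where $S_n$ is the symmetric group on $\{1,\dots,n\}$ (so $A_0=1$), $\ell(\pi)$ is the number of inversions of $\pi$ (its Coxeter length with respect to adjacent transpositions), and ${\rm maj}(\pi)=\sum\{\,j: \pi(j)>\pi(j+1)\,\}$ is the major index. $(r)_n:=(1-r)(1-r^2)\cdots(1-r^n)$, $(r)_0=1$. *)

theory Defs
  imports
    Complex_Main
    "HOL-Combinatorics.Permutations"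
    "HOL-Computational_Algebra.Polynomial_Factorial"
begin

definition inversion_number :: "nat \<Rightarrow> (nat \<Rightarrow> nat) \<Rightarrow> nat" where
  "inversion_number n \<pi> =
     card {(a, b). a \<in> {1..n} \<and> b \<in> {1..n} \<and> a < b \<and> \<pi> a > \<pi> b}"

definition major_index :: "nat \<Rightarrow> (nat \<Rightarrow> nat) \<Rightarrow> nat" where
  "major_index n \<pi> = \<Sum>{j \<in> {1..<n}. \<pi> j > \<pi> (j + 1)}"

definition inv_maj_poly :: "nat \<Rightarrow> 'a :: comm_ring_1 \<Rightarrow> 'a \<Rightarrow> 'a" where
  "inv_maj_poly n t r =
     (\<Sum>\<pi> | \<pi> permutes {1..n}. t ^ inversion_number n \<pi> * r ^ major_index n \<pi>)"

definition q_factor :: "'a :: comm_ring_1 \<Rightarrow> nat \<Rightarrow> 'a" where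
  "q_factor r n = (\<Prod>j = 1..n. 1 - r ^ j)"

definition primitive_root_of_unity :: "nat \<Rightarrow> 'a :: comm_ring_1 \<Rightarrow> bool" where
  "primitive_root_of_unity m \<zeta> \<longleftrightarrow>
     m > 0 \<and> \<zeta> ^ m = 1 \<and> (\<forall>j. 0 < j \<and> j < m \<longrightarrow> \<zeta> ^ j \<noteq> 1)"

text \<open>
  The type \<^typ>\<open>complex poly fract\<close> is the field of rational functions in one
  indeterminate over the complex numbers; below are the embedding of the constants and
  the indeterminate itself.
\<close>

definition ratfun_const :: "complex \<Rightarrow> complex poly fract" where
  "ratfun_const c = to_fract [:c:]"

definition ratfun_X :: "complex poly fract" where
  "ratfun_X = to_fract [:0, 1:]"

end

theory Submission
  imports Defs "HOL-Combinatorics.Multiset_Permutations"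
begin

text \<open>
  Write \<open>B\<^sub>n = A\<^sub>n / (r)\<^sub>n\<close>. Expanding the factor \<open>1\<close> contributed to \<open>r\<^bsup>maj\<^esup>\<close> by each
  non-descent \<open>j\<close> as \<open>r\<^bsup>j\<^esup> + (1 - r\<^bsup>j\<^esup>)\<close> and sorting the terms by the last position \<open>k\<close> at
  which \<open>r\<^bsup>k\<^esup>\<close> is chosen, the permutation ascends after \<open>k\<close>, hence is a \<open>k\<close>-subset together
  with an arrangement of it. This gives \<open>B\<^sub>n = \<Sum>k\<le>n. r\<^bsup>k\<^esup> [n choose k]\<^sub>t B\<^sub>k\<close>, which determines
  \<open>B\<close> from \<open>B\<^sub>0 = 1\<close>. At a primitive \<open>m\<close>-th root of unity the Gaussian binomials satisfy the
  \<open>q\<close>-Lucas congruence as an equality, and by the binomial theorem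
  \<open>B\<^sub>i / (1 - r\<^bsup>m\<^esup>)\<^bsup>k\<^esup>\<close> at index \<open>m k + i\<close> solves the same recurrence.
\<close>

section \<open>Gaussian binomials: product form, roots of unity, counting of subsets\<close>

fun gauss_binomial :: "'a :: comm_ring_1 \<Rightarrow> nat \<Rightarrow> nat \<Rightarrow> 'a" where
  "gauss_binomial t n 0 = 1"
| "gauss_binomial t 0 (Suc k) = 0"
| "gauss_binomial t (Suc n) (Suc k) =
     t ^ (n - k) * gauss_binomial t n k + gauss_binomial t n (Suc k)"

lemma gauss_binomial_eq_0: "n < k \<Longrightarrow> gauss_binomial t n k = 0"
  by (induction t n k rule: gauss_binomial.induct) auto

lemma gauss_binomial_self [simp]: "gauss_binomial t n n = 1"
  by (induction n) (auto simp: gauss_binomial_eq_0)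

lemma q_factor_0 [simp]: "q_factor r 0 = 1"
  by (simp add: q_factor_def)

lemma q_factor_Suc: "q_factor r (Suc n) = q_factor r n * (1 - r ^ Suc n)"
  by (simp add: q_factor_def)

text \<open>The product form is stated without division because the factors can vanish at roots of
  unity. In the induction on \<open>i + j\<close>, the two Pascal terms combine through t^j (1 -
  t^i) + (1 - t^j) = 1 - t^(i+j).\<close>

lemma gauss_binomial_q_factor:
  "gauss_binomial t (i + j) i * (q_factor t i * q_factor t j) = q_factor t (i + j)"
proof (induction "i + j" arbitrary: i j)
  case 0
  then show ?case by simp
next
  case (Suc s)
  show ?case
  proof (cases i)
    case 0
    then show ?thesis by simp
  next
    case i: (Suc i')
    show ?thesis
    proof (cases j)
      case 0
      then show ?thesis by simp
    next
      case j: (Suc j')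
      have s: "s = i' + j" "s = i + j'" "s - i' = j" "i + j = Suc s"
        using Suc.hyps(2) i j by auto
      have IH1: "gauss_binomial t s i' * (q_factor t i' * q_factor t j) = q_factor t s"
        using Suc.hyps(1)[OF s(1)] unfolding s(1)[symmetric] .
      have IH2: "gauss_binomial t s i * (q_factor t i * q_factor t j') = q_factor t s"
        using Suc.hyps(1)[OF s(2)] unfolding s(2)[symmetric] .
      have "gauss_binomial t (i + j) i * (q_factor t i * q_factor t j) =
          (t ^ j * gauss_binomial t s i' + gauss_binomial t s i) * (q_factor t i * q_factor t j)"
        unfolding s(4) by (simp add: i s(3)[symmetric])
      also have "\<dots> = t ^ j * (1 - t ^ i) *
            (gauss_binomial t s i' * (q_factor t i' * q_factor t j)) +
          (1 - t ^ j) * (gauss_binomial t s i * (q_factor t i * q_factor t j'))"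
        by (simp add: i j q_factor_Suc algebra_simps)
      also have "\<dots> = (t ^ j * (1 - t ^ i) + (1 - t ^ j)) * q_factor t s"
        unfolding IH1 IH2 by (simp add: algebra_simps)
      also have "\<dots> = q_factor t (i + j)"
        unfolding s(4) q_factor_Suc using Suc.hyps(2)
        by (simp add: algebra_simps flip: power_add)
      finally show ?thesis .
    qed
  qed
qed

lemma q_factor_eq_0_iff:
  fixes r :: "'a :: idom"
  shows "q_factor r n = 0 \<longleftrightarrow> (\<exists>j\<in>{1..n}. r ^ j = 1)"
  by (auto simp: q_factor_def)

text \<open>The factor 1 - t^m makes \<open>q_factor t m\<close> vanish, while for 0 < j < m the
  other two factors of the product form contain only powers of t below m and are nonzero. In an
  integral domain this kills the inner coefficients.\<close>

lemma gauss_binomial_primitive_root: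
  fixes t :: "'a :: idom"
  assumes "primitive_root_of_unity m t"
  shows "gauss_binomial t m j = (if j = 0 \<or> j = m then 1 else 0)"
proof -
  have "gauss_binomial t m j = 0" if j: "0 < j" "j < m"
  proof -
    have "gauss_binomial t m j * (q_factor t j * q_factor t (m - j)) = q_factor t m"
      using gauss_binomial_q_factor[of t j "m - j"] j by simp
    moreover have "q_factor t m = 0"
      using assms by (auto simp: q_factor_eq_0_iff primitive_root_of_unity_def intro!: bexI[of _ m])
    moreover have "q_factor t j \<noteq> 0" "q_factor t (m - j) \<noteq> 0"
      using assms j by (auto simp: q_factor_eq_0_iff primitive_root_of_unity_def)
    ultimately show ?thesis by simp
  qed
  then show ?thesis
    by (cases "j > m") (auto simp: gauss_binomial_eq_0)
qed

text \<open>Since t^m = 1, the Pascal weights do not change when the upper index grows by m, so the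
  claim propagates from the row n = 0. For variables with yx = t xy it reads (x + y)^(n+m) = (x +
  y)^n (x^m + y^m).\<close>

lemma gauss_binomial_add_order:
  fixes t :: "'a :: idom"
  assumes "primitive_root_of_unity m t"
  shows "gauss_binomial t (n + m) j =
           gauss_binomial t n j + (if m \<le> j then gauss_binomial t n (j - m) else 0)"
proof (induction n arbitrary: j)
  case 0
  have "m > 0" using assms by (simp add: primitive_root_of_unity_def)
  then show ?case
    using gauss_binomial_primitive_root[OF assms, of j]
    by (cases j; cases "j - m") auto
next
  case (Suc n)
  have m: "m > 0" "t ^ m = 1" using assms by (auto simp: primitive_root_of_unity_def)
  show ?case
  proof (cases j)
    case 0
    then show ?thesis using m by simp
  next
    case j: (Suc l)
    \<comment> \<open>For l > n truncated subtraction spoils the comparison of exponents, but then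
      the coefficient is zero.\<close>
    have pw: "t ^ (n + m - l) * gauss_binomial t n l = t ^ (n - l) * gauss_binomial t n l"
    proof (cases "l \<le> n")
      case True
      then have "n + m - l = (n - l) + m" by simp
      then show ?thesis by (simp add: power_add m)
    qed (simp add: gauss_binomial_eq_0)
    have step: "gauss_binomial t (Suc n + m) (Suc l) =
        t ^ (n - l) * gauss_binomial t n l +
        t ^ (n + m - l) * (if m \<le> l then gauss_binomial t n (l - m) else 0) +
        (gauss_binomial t n (Suc l) +
          (if m \<le> Suc l then gauss_binomial t n (Suc l - m) else 0))"
      by (simp add: Suc.IH distrib_left pw)
    \<comment> \<open>The shifted lower index \<open>Suc l - m\<close> is positive, zero or absent;
      Pascal's rule applies to it only when it is positive.\<close>
    consider "m \<le> l" | "m = Suc l" | "Suc l < m" by linarith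
    then show ?thesis
    proof cases
      case 1
      then show ?thesis unfolding j step by (simp add: Suc_diff_le)
    next
      case 2
      then show ?thesis unfolding j step by simp
    next
      case 3
      then show ?thesis unfolding j step by simp
    qed
  qed
qed

text \<open>Each induction step removes one block of m from the upper index; the two resulting terms
  recombine by Pascal's rule for the ordinary binomial \<open>k choose a\<close>.\<close>

lemma gauss_binomial_lucas:
  fixes t :: "'a :: idom"
  assumes "primitive_root_of_unity m t" "i < m" "b < m"
  shows "gauss_binomial t (m * k + i) (m * a + b) = of_nat (k choose a) * gauss_binomial t i b"
proof (induction k arbitrary: a)
  case 0
  then show ?case
    using assms by (cases a) (auto simp: gauss_binomial_eq_0)
next
  case (Suc k)
  have "m * Suc k + i = (m * k + i) + m" by simp
  then have *: "gauss_binomial t (m * Suc k + i) (m * a + b) = gauss_binomial t (m * k + i) (m * a + b)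
     + (if m \<le> m * a + b then gauss_binomial t (m * k + i) (m * a + b - m) else 0)"
    by (metis gauss_binomial_add_order[OF assms(1)])
  show ?case
  proof (cases a)
    case 0
    then show ?thesis using * Suc.IH[of 0] assms(3) by simp
  next
    case (Suc a')
    then have "m * a + b - m = m * a' + b" "m \<le> m * a + b" by auto
    then show ?thesis
      using * Suc.IH[of a'] Suc.IH[of a] Suc by (simp add: algebra_simps)
  qed
qed

text \<open>Inversions between an arrangement of \<open>A\<close> and the entries of \<open>{1..n} - A\<close> placed after it.\<close>

definition cross_inversions :: "nat \<Rightarrow> nat set \<Rightarrow> nat" where
  "cross_inversions n A = (\<Sum>a\<in>A. card {b \<in> {1..n} - A. b < a})"

text \<open>Subsets are split by whether they contain \<open>Suc n\<close>. If so, it exceeds all n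
  - k omitted elements, which is the weight t^(n-k) of the Pascal rule; if not, it exceeds every
  element of A and adds no inversion.\<close>

lemma sum_cross_inversions:
  fixes t :: "'a :: comm_ring_1"
  shows "(\<Sum>A | A \<subseteq> {1..n} \<and> card A = k. t ^ cross_inversions n A) = gauss_binomial t n k"
proof (induction t n k rule: gauss_binomial.induct)
  case (1 t n)
  have "{A. A \<subseteq> {1..n} \<and> card A = 0} = {{}}"
    by (auto dest: finite_subset)
  then show ?case by (simp add: cross_inversions_def)
next
  case (2 t k)
  have "{A. A \<subseteq> {1..0::nat} \<and> card A = Suc k} = {}" by auto
  then show ?case by (simp only: sum.empty gauss_binomial.simps)
next
  case (3 t n k)
  let ?S = "\<lambda>n k. {A. A \<subseteq> {1..n::nat} \<and> card A = k}"
  have fin: "finite (?S n k)" for n k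
    by (rule finite_subset[of _ "Pow {1..n}"]) auto
  have split: "?S (Suc n) (Suc k) = insert (Suc n) ` ?S n k \<union> ?S n (Suc k)"
  proof (intro equalityI subsetI)
    fix A assume A: "A \<in> ?S (Suc n) (Suc k)"
    show "A \<in> insert (Suc n) ` ?S n k \<union> ?S n (Suc k)"
    proof (cases "Suc n \<in> A")
      case True
      then have "A = insert (Suc n) (A - {Suc n})" "A - {Suc n} \<in> ?S n k"
        using A by (auto simp: le_Suc_eq subset_iff)
      then show ?thesis by blast
    next
      case False
      then show ?thesis using A by (auto simp: le_Suc_eq subset_iff)
    qed
  next
    fix A assume "A \<in> insert (Suc n) ` ?S n k \<union> ?S n (Suc k)"
    then show "A \<in> ?S (Suc n) (Suc k)"
    proof
      assume "A \<in> insert (Suc n) ` ?S n k"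
      then obtain B where B: "A = insert (Suc n) B" "B \<subseteq> {1..n}" "card B = k" by auto
      moreover have "finite B" "Suc n \<notin> B" using B(2) by (auto intro: finite_subset)
      ultimately show ?thesis by auto
    qed auto
  qed
  have disj: "insert (Suc n) ` ?S n k \<inter> ?S n (Suc k) = {}" by auto
  have inj: "inj_on (insert (Suc n)) (?S n k)"
  proof (rule inj_onI)
    fix A B assume "A \<in> ?S n k" "B \<in> ?S n k" "insert (Suc n) A = insert (Suc n) B"
    moreover from this have "Suc n \<notin> A" "Suc n \<notin> B" by auto
    ultimately show "A = B" by (simp add: insert_ident)
  qed
  have old: "cross_inversions (Suc n) A = cross_inversions n A" if "A \<subseteq> {1..n}" for A
    unfolding cross_inversions_def
    by (rule sum.cong) (use that in \<open>force intro!: arg_cong[of _ _ card]\<close>)+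
  have new: "cross_inversions (Suc n) (insert (Suc n) A) = (n - k) + cross_inversions n A"
    if A: "A \<in> ?S n k" for A
  proof -
    have "finite A" "Suc n \<notin> A" using A by (auto intro: finite_subset)
    have "{b \<in> {1..Suc n} - insert (Suc n) A. b < Suc n} = {1..n} - A" by auto
    moreover have "card ({1..n} - A) = n - k"
      using A \<open>finite A\<close> by (simp add: card_Diff_subset)
    moreover have "{b \<in> {1..Suc n} - insert (Suc n) A. b < a} = {b \<in> {1..n} - A. b < a}" if "a \<in> A" for a
      using A that by auto
    ultimately show ?thesis
      unfolding cross_inversions_def using \<open>finite A\<close> \<open>Suc n \<notin> A\<close> by simp
  qed
  have "(\<Sum>A\<in>?S (Suc n) (Suc k). t ^ cross_inversions (Suc n) A) =
     (\<Sum>A\<in>?S n k. t ^ cross_inversions (Suc n) (insert (Suc n) A)) +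
     (\<Sum>A\<in>?S n (Suc k). t ^ cross_inversions (Suc n) A)"
    unfolding split sum.union_disjoint[OF finite_imageI[OF fin] fin disj] sum.reindex[OF inj] o_def ..
  also have "\<dots> = (\<Sum>A\<in>?S n k. t ^ (n - k) * t ^ cross_inversions n A) +
     (\<Sum>A\<in>?S n (Suc k). t ^ cross_inversions n A)"
    by (intro arg_cong2[of _ _ _ _ "(+)"] sum.cong refl) (simp_all add: new old power_add)
  also have "\<dots> = gauss_binomial t (Suc n) (Suc k)"
    using 3 by (simp flip: sum_distrib_left)
  finally show ?case .
qed

section \<open>Permutations as words, and standardization\<close>

fun inversions :: "nat list \<Rightarrow> nat" where
  "inversions [] = 0"
| "inversions (x # xs) = length (filter (\<lambda>y. y < x) xs) + inversions xs"

text \<open>The index shift keeps the one-based descent positions of \<open>major_index\<close> on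
  zero-based lists.\<close>

definition major :: "nat list \<Rightarrow> nat" where
  "major xs = \<Sum>{j \<in> {1..<length xs}. xs ! (j - 1) > xs ! j}"

text \<open>A general ground set is needed because a prefix of a permutation arranges an arbitrary
  subset of the values.\<close>

definition inv_maj_sum :: "'a :: comm_ring_1 \<Rightarrow> 'a \<Rightarrow> nat set \<Rightarrow> 'a" where
  "inv_maj_sum t r S = (\<Sum>xs\<in>permutations_of_set S. t ^ inversions xs * r ^ major xs)"

lemma inversions_append:
  "inversions (xs @ ys) =
     inversions xs + inversions ys + (\<Sum>x\<leftarrow>xs. length (filter (\<lambda>y. y < x) ys))"
  by (induction xs) auto

lemma inversions_sorted: "sorted xs \<Longrightarrow> inversions xs = 0"
  by (induction xs) (auto simp: filter_empty_conv)

lemma inversions_map: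
  assumes "strict_mono_on S f" "set xs \<subseteq> S"
  shows "inversions (map f xs) = inversions xs"
  using assms(2)
proof (induction xs)
  case (Cons x xs)
  have "filter (\<lambda>y. f y < f x) xs = filter (\<lambda>y. y < x) xs"
    by (rule filter_cong) (use Cons.prems assms(1) in \<open>auto simp: strict_mono_on_less\<close>)
  with Cons show ?case by (simp add: filter_map o_def)
qed simp

lemma major_map:
  assumes "strict_mono_on S f" "set xs \<subseteq> S"
  shows "major (map f xs) = major xs"
proof -
  have "f (xs ! i) < f (xs ! j) \<longleftrightarrow> xs ! i < xs ! j" if "i < length xs" "j < length xs" for i j
    using assms that by (meson nth_mem strict_mono_on_less subsetD)
  then show ?thesis
    unfolding major_def by (intro arg_cong[of _ _ "sum _"]) auto
qed

text \<open>Both statistics depend only on the relative order of the entries.\<close>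

lemma inv_maj_sum_image:
  assumes "strict_mono_on S f"
  shows "inv_maj_sum t r (f ` S) = inv_maj_sum t r S"
proof -
  have inj: "inj_on f S" using assms by (rule strict_mono_on_imp_inj_on)
  have "permutations_of_set (f ` S) = map f ` permutations_of_set S"
    by (rule permutations_of_set_image_inj[OF inj])
  moreover have "inj_on (map f) (permutations_of_set S)"
    by (rule inj_onI) (use inj in \<open>auto simp: permutations_of_set_def inj_on_map_eq_map\<close>)
  ultimately show ?thesis
    unfolding inv_maj_sum_def
    by (simp add: sum.reindex)
       (intro sum.cong refl, use inversions_map[OF assms] major_map[OF assms] in \<open>auto simp: permutations_of_set_def\<close>)
qed

lemma inversion_number_Suc:
  "inversion_number (Suc n) \<pi> = inversion_number n \<pi> + card {a \<in> {1..n}. \<pi> a > \<pi> (Suc n)}"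
proof -
  let ?I = "\<lambda>n. {(a, b). a \<in> {1..n} \<and> b \<in> {1..n} \<and> a < b \<and> \<pi> a > \<pi> b}"
  let ?J = "{a \<in> {1..n}. \<pi> a > \<pi> (Suc n)}"
  have "?I (Suc n) = ?I n \<union> (\<lambda>a. (a, Suc n)) ` ?J"
    by (auto simp: le_Suc_eq)
  moreover have "finite (?I n)"
    by (rule finite_subset[of _ "{1..n} \<times> {1..n}"]) auto
  moreover have "?I n \<inter> (\<lambda>a. (a, Suc n)) ` ?J = {}" by auto
  moreover have "card ((\<lambda>a. (a, Suc n)) ` ?J) = card ?J"
    by (rule card_image) (auto simp: inj_on_def)
  ultimately show ?thesis
    unfolding inversion_number_def by (simp add: card_Un_disjoint)
qed

lemma inversions_map_upt: "inversions (map \<pi> [1..<Suc n]) = inversion_number n \<pi>"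
proof (induction n)
  case 0
  then show ?case by (simp add: inversion_number_def)
next
  case (Suc n)
  have "(\<Sum>x\<leftarrow>map \<pi> xs. length (filter (\<lambda>y. y < x) [c])) =
      length (filter (\<lambda>a. \<pi> a > c) xs)" for xs c
    by (induction xs) auto
  then have "(\<Sum>x\<leftarrow>map \<pi> [1..<Suc n]. length (filter (\<lambda>y. y < x) [\<pi> (Suc n)])) =
      length (filter (\<lambda>a. \<pi> a > \<pi> (Suc n)) [1..<Suc n])" .
  also have "\<dots> = card {a \<in> {1..n}. \<pi> a > \<pi> (Suc n)}"
    by (subst distinct_length_filter) (auto intro!: arg_cong[of _ _ card])
  finally show ?case
    using Suc by (simp add: inversion_number_Suc inversions_append)
qed

lemma major_map_upt: "major (map \<pi> [1..<Suc n]) = major_index n \<pi>"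
  unfolding major_def major_index_def
  by (intro arg_cong[of _ _ "sum _"]) (auto simp del: upt_Suc)

lemma bij_betw_permutes_lists:
  "bij_betw (\<lambda>\<pi>. map \<pi> [1..<Suc n]) {\<pi>. \<pi> permutes {1..n}} (permutations_of_set {1..n})"
proof -
  let ?f = "\<lambda>\<pi>::nat \<Rightarrow> nat. map \<pi> [1..<Suc n]"
  let ?P = "{\<pi>. \<pi> permutes {1..n}}"
  have inj: "inj_on ?f ?P"
  proof (rule inj_onI)
    fix \<pi> \<sigma> assume *: "\<pi> \<in> ?P" "\<sigma> \<in> ?P" "?f \<pi> = ?f \<sigma>"
    show "\<pi> = \<sigma>"
    proof
      fix x
      show "\<pi> x = \<sigma> x"
        using * by (cases "x \<in> {1..n}") (auto simp: permutes_not_in simp del: upt_Suc)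
    qed
  qed
  have sub: "?f ` ?P \<subseteq> permutations_of_set {1..n}"
    by (auto simp: permutations_of_set_def permutes_image distinct_map atLeastLessThanSuc_atLeastAtMost
          permutes_inj_on simp del: upt_Suc)
  \<comment> \<open>Surjectivity comes from counting: both sets have n! elements.\<close>
  have "card (?f ` ?P) = card (permutations_of_set {1..n})"
    using card_image[OF inj] card_permutations[of "{1..n}" n] by simp
  then have "?f ` ?P = permutations_of_set {1..n}"
    by (intro card_subset_eq sub) auto
  with inj show ?thesis by (simp add: bij_betw_def)
qed

lemma inv_maj_poly_eq_sum: "inv_maj_poly n t r = inv_maj_sum t r {1..n}"
  unfolding inv_maj_poly_def inv_maj_sum_def
  by (subst sum.reindex_bij_betw[OF bij_betw_permutes_lists, symmetric])
     (simp only: inversions_map_upt major_map_upt)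

text \<open>Standardization: the increasing enumeration of S starts at 0, and a further shift by
  \<open>Suc\<close> reaches {1..card S}.\<close>

lemma inv_maj_sum_card:
  assumes "finite S"
  shows "inv_maj_sum t r S = inv_maj_poly (card S) t r"
proof -
  obtain h where h: "bij_betw h {..<card S} S" "strict_mono_on {..<card S} h"
    using ex_bij_betw_strict_mono_card[OF assms] .
  have "inv_maj_sum t r S = inv_maj_sum t r {..<card S}"
    using inv_maj_sum_image[OF h(2)] h(1) by (simp add: bij_betw_def)
  also have "\<dots> = inv_maj_sum t r (Suc ` {..<card S})"
    by (rule inv_maj_sum_image[symmetric]) (auto simp: strict_mono_on_def)
  also have "\<dots> = inv_maj_poly (card S) t r"
    by (simp add: inv_maj_poly_eq_sum image_Suc_lessThan)
  finally show ?thesis .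
qed

section \<open>Expansion of r^maj and the recurrence\<close>

lemma major_index_0 [simp]: "major_index 0 \<pi> = 0"
  by (simp add: major_index_def)

lemma major_index_1 [simp]: "major_index (Suc 0) \<pi> = 0"
  by (simp add: major_index_def)

lemma major_index_Suc:
  assumes "n > 0"
  shows "major_index (Suc n) \<pi> = major_index n \<pi> + (if \<pi> n > \<pi> (Suc n) then n else 0)"
proof -
  let ?D = "\<lambda>n. {j \<in> {1..<n}. \<pi> j > \<pi> (j + 1)}"
  have "?D (Suc n) = (if \<pi> n > \<pi> (Suc n) then insert n (?D n) else ?D n)"
    using assms by (auto simp: less_Suc_eq)
  then show ?thesis by (simp add: major_index_def)
qed

text \<open>Position \<open>k\<close> itself stays free: r^k can be chosen there at a descent and at
  an ascent alike.\<close>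

definition ascending_from :: "nat \<Rightarrow> nat \<Rightarrow> (nat \<Rightarrow> nat) \<Rightarrow> bool" where
  "ascending_from k n \<pi> \<longleftrightarrow> (\<forall>j. k < j \<and> j < n \<longrightarrow> \<pi> j \<le> \<pi> (Suc j))"

text \<open>Induction on the newest position \<open>Suc n\<close>. A descent there kills all old
  terms and an ascent multiplies them by 1 - r^(Suc n); the new top term contributes r^(Suc n) in
  both cases. The total factor is thus r^(Suc n) or 1, as the major index demands. The term k = 0
  stands for never choosing r^j.\<close>

lemma major_index_expansion:
  fixes r :: "'a :: comm_ring_1"
  shows "r ^ major_index (Suc n) \<pi> =
    (\<Sum>k\<le>n. if ascending_from k (Suc n) \<pi>
       then r ^ k * (\<Prod>j\<in>{k<..n}. 1 - r ^ j) * r ^ major_index k \<pi> else 0)"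
proof (induction n)
  case 0
  then show ?case by (simp add: ascending_from_def)
next
  case (Suc n)
  let ?T = "\<lambda>n k. if ascending_from k (Suc n) \<pi>
       then r ^ k * (\<Prod>j\<in>{k<..n}. 1 - r ^ j) * r ^ major_index k \<pi> else 0"
  have asc: "ascending_from k (Suc (Suc n)) \<pi> \<longleftrightarrow>
      ascending_from k (Suc n) \<pi> \<and> \<pi> (Suc n) \<le> \<pi> (Suc (Suc n))" if "k \<le> n" for k
    using that by (auto simp: ascending_from_def elim!: less_SucE)
  have top: "ascending_from (Suc n) (Suc (Suc n)) \<pi>"
    by (auto simp: ascending_from_def)
  have "?T (Suc n) k = (if \<pi> (Suc n) \<le> \<pi> (Suc (Suc n)) then 1 - r ^ Suc n else 0) * ?T n k"
    if "k \<le> n" for k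
  proof -
    have "{k<..Suc n} = insert (Suc n) {k<..n}" using that by auto
    then show ?thesis using asc[OF that] by simp
  qed
  then have "(\<Sum>k\<le>n. ?T (Suc n) k) =
     (if \<pi> (Suc n) \<le> \<pi> (Suc (Suc n)) then 1 - r ^ Suc n else 0) * r ^ major_index (Suc n) \<pi>"
    unfolding Suc.IH sum_distrib_left by (intro sum.cong) auto
  moreover have "?T (Suc n) (Suc n) = r ^ Suc n * r ^ major_index (Suc n) \<pi>"
    using top by simp
  ultimately have "(\<Sum>k\<le>Suc n. ?T (Suc n) k) = r ^ major_index (Suc (Suc n)) \<pi>"
    by (simp add: major_index_Suc power_add algebra_simps)
  then show ?case ..
qed

text \<open>A sorted suffix is determined by its set of values, so the word amounts to a k-subset A
  with an arrangement of A as prefix. Its inversions lie within the prefix or run from prefix to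
  suffix, and the latter depend only on A.\<close>

lemma sum_sorted_suffix:
  fixes t r :: "'a :: comm_ring_1"
  assumes "k \<le> n"
  shows "(\<Sum>ys | ys \<in> permutations_of_set {1..n} \<and> sorted (drop k ys).
            t ^ inversions ys * r ^ major (take k ys)) =
         gauss_binomial t n k * inv_maj_poly k t r"
proof -
  let ?S = "{A. A \<subseteq> {1..n} \<and> card A = k}"
  let ?L = "{ys. ys \<in> permutations_of_set {1..n} \<and> sorted (drop k ys)}"
  let ?app = "\<lambda>(A, xs). xs @ sorted_list_of_set ({1..n} - A)"
  have fin: "finite ?S"
    by (rule finite_subset[of _ "Pow {1..n}"]) auto
  have "(\<Sum>ys\<in>?L. t ^ inversions ys * r ^ major (take k ys)) =
     (\<Sum>(A, xs)\<in>Sigma ?S permutations_of_set.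
        t ^ cross_inversions n A * (t ^ inversions xs * r ^ major xs))"
  proof (rule sum.reindex_bij_witness[of _ ?app "\<lambda>ys. (set (take k ys), take k ys)"])
    fix ys assume "ys \<in> ?L"
    then have ys: "set ys = {1..n}" "distinct ys" "sorted (drop k ys)"
      by (auto simp: permutations_of_set_def)
    have len: "length ys = n" using distinct_card[OF ys(2)] ys(1) by simp
    have "set (take k ys) \<union> set (drop k ys) = {1..n}"
      using ys(1) by (metis append_take_drop_id set_append)
    moreover have "set (take k ys) \<inter> set (drop k ys) = {}"
      using ys(2) by (metis append_take_drop_id distinct_append)
    ultimately have diff: "{1..n} - set (take k ys) = set (drop k ys)" by auto
    have sl: "sorted_list_of_set (set (drop k ys)) = drop k ys"
      using ys by (simp add: sorted_list_of_set.idem_if_sorted_distinct)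
    show app: "?app (set (take k ys), take k ys) = ys"
      unfolding prod.case diff sl by simp
    show "(set (take k ys), take k ys) \<in> Sigma ?S permutations_of_set"
      using ys len assms by (auto simp: permutations_of_set_def distinct_card dest: in_set_takeD)
    have "(\<Sum>x\<leftarrow>take k ys. length (filter (\<lambda>y. y < x) (drop k ys))) =
        (\<Sum>x\<in>set (take k ys). length (filter (\<lambda>y. y < x) (drop k ys)))"
      using ys(2) by (simp add: sum_list_distinct_conv_sum_set)
    also have "\<dots> = cross_inversions n (set (take k ys))"
      unfolding cross_inversions_def diff using ys(2)
      by (intro sum.cong refl) (auto simp: distinct_length_filter intro!: arg_cong[of _ _ card])
    finally have "inversions ys = inversions (take k ys) + cross_inversions n (set (take k ys))"
      using inversions_append[of "take k ys" "drop k ys"] inversions_sorted[OF ys(3)] by simp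
    then show "(case (set (take k ys), take k ys) of (A, xs) \<Rightarrow>
         t ^ cross_inversions n A * (t ^ inversions xs * r ^ major xs)) =
       t ^ inversions ys * r ^ major (take k ys)"
      by (simp add: power_add algebra_simps)
  next
    fix p assume "p \<in> Sigma ?S permutations_of_set"
    then obtain A xs where p: "p = (A, xs)" "A \<subseteq> {1..n}" "card A = k" "set xs = A" "distinct xs"
      by (auto simp: permutations_of_set_def)
    have len: "length xs = k" using distinct_card[OF p(5)] p by simp
    show "(set (take k (?app p)), take k (?app p)) = p"
      using p len by simp
    show "?app p \<in> ?L"
      using p len by (auto simp: permutations_of_set_def)
  qed
  \<comment> \<open>Summing over the arrangements of a fixed A leaves a factor that depends only on
    \<open>card A = k\<close>.\<close>
  also have "\<dots> = (\<Sum>A\<in>?S. t ^ cross_inversions n A * inv_maj_sum t r A)"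
    using fin unfolding inv_maj_sum_def
    by (subst sum.Sigma[symmetric]) (auto simp: sum_distrib_left)
  also have "\<dots> = (\<Sum>A\<in>?S. t ^ cross_inversions n A) * inv_maj_poly k t r"
    unfolding sum_distrib_right
    by (intro sum.cong refl) (auto simp: inv_maj_sum_card finite_subset)
  finally show ?thesis
    by (simp only: sum_cross_inversions)
qed

lemma sum_ascending_from:
  fixes t r :: "'a :: comm_ring_1"
  assumes "k \<le> n"
  shows "(\<Sum>\<pi> | \<pi> permutes {1..n} \<and> ascending_from k n \<pi>.
            t ^ inversion_number n \<pi> * r ^ major_index k \<pi>) =
         gauss_binomial t n k * inv_maj_poly k t r"
proof -
  have asc: "ascending_from k n \<pi> \<longleftrightarrow> sorted (drop k (map \<pi> [1..<Suc n]))" for \<pi>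
  proof
    assume *: "ascending_from k n \<pi>"
    show "sorted (drop k (map \<pi> [1..<Suc n]))"
      unfolding sorted_iff_nth_Suc
      using * by (auto simp: ascending_from_def simp del: upt_Suc)
  next
    assume *: "sorted (drop k (map \<pi> [1..<Suc n]))"
    show "ascending_from k n \<pi>"
      unfolding ascending_from_def
    proof (intro allI impI)
      fix j assume "k < j \<and> j < n"
      then have j: "k < j" "j < n" by auto
      \<comment> \<open>Dropping k entries and counting from zero puts the value at position j at
        index \<open>j - Suc k\<close>.\<close>
      then have "Suc (j - Suc k) < length (drop k (map \<pi> [1..<Suc n]))"
        by (simp del: upt_Suc)
      with * have "drop k (map \<pi> [1..<Suc n]) ! (j - Suc k) \<le> drop k (map \<pi> [1..<Suc n]) ! Suc (j - Suc k)"
        unfolding sorted_iff_nth_Suc by blast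
      then show "\<pi> j \<le> \<pi> (Suc j)"
        using j by (simp del: upt_Suc)
    qed
  qed
  have "take k (map \<pi> [1..<Suc n]) = map \<pi> [1..<Suc k]" for \<pi> :: "nat \<Rightarrow> nat"
    using assms by (simp add: take_map take_upt del: upt_Suc)
  then have "(\<Sum>\<pi> | \<pi> permutes {1..n} \<and> ascending_from k n \<pi>.
        t ^ inversion_number n \<pi> * r ^ major_index k \<pi>) =
      (\<Sum>\<pi> | \<pi> permutes {1..n} \<and> sorted (drop k (map \<pi> [1..<Suc n])).
        t ^ inversions (map \<pi> [1..<Suc n]) * r ^ major (take k (map \<pi> [1..<Suc n])))"
    by (simp only: asc inversions_map_upt major_map_upt)
  also have "\<dots> = (\<Sum>ys | ys \<in> permutations_of_set {1..n} \<and> sorted (drop k ys).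
      t ^ inversions ys * r ^ major (take k ys))"
    by (rule sum.reindex_bij_betw[of "\<lambda>\<pi>. map \<pi> [1..<Suc n]"])
       (use bij_betw_permutes_lists[of n] in \<open>auto simp: bij_betw_def inj_on_def image_iff simp del: upt_Suc map_eq_conv\<close>)
  finally show ?thesis using sum_sorted_suffix[OF assms] by simp
qed

text \<open>The expansion does not touch the power of t, so exchanging the sums leaves, for each k,
  a sum over permutations ascending after k. The range ends at n, the last possible descent of a
  permutation of n + 1 letters.\<close>

lemma inv_maj_poly_recurrence:
  "inv_maj_poly (Suc n) t r =
     (\<Sum>k\<le>n. r ^ k * (\<Prod>j\<in>{k<..n}. 1 - r ^ j) *
        (gauss_binomial t (Suc n) k * inv_maj_poly k t r))"
proof -
  let ?P = "{\<pi>. \<pi> permutes {1..Suc n}}"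
  let ?c = "\<lambda>k. r ^ k * (\<Prod>j\<in>{k<..n}. 1 - r ^ j)"
  let ?w = "\<lambda>k \<pi>. t ^ inversion_number (Suc n) \<pi> * r ^ major_index k \<pi>"
  have fin: "finite ?P" by (rule finite_permutations) simp
  have "inv_maj_poly (Suc n) t r =
      (\<Sum>\<pi>\<in>?P. \<Sum>k\<le>n. if ascending_from k (Suc n) \<pi> then ?c k * ?w k \<pi> else 0)"
    unfolding inv_maj_poly_def major_index_expansion sum_distrib_left
    by (intro sum.cong refl) (simp add: algebra_simps)
  also have "\<dots> = (\<Sum>k\<le>n. \<Sum>\<pi>\<in>?P. if ascending_from k (Suc n) \<pi> then ?c k * ?w k \<pi> else 0)"
    by (rule sum.swap)
  also have "\<dots> = (\<Sum>k\<le>n. ?c k * (\<Sum>\<pi> | \<pi> permutes {1..Suc n} \<and> ascending_from k (Suc n) \<pi>. ?w k \<pi>))"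
    unfolding sum_distrib_left
    by (rule sum.cong[OF refl]) (simp only: sum.inter_filter[OF fin, symmetric] mem_Collect_eq)
  also have "\<dots> = (\<Sum>k\<le>n. ?c k * (gauss_binomial t (Suc n) k * inv_maj_poly k t r))"
    by (rule sum.cong[OF refl]) (subst sum_ascending_from, simp_all)
  finally show ?thesis .
qed

section \<open>The normalized recurrence and its solution at a root of unity\<close>

lemma q_factor_split:
  assumes "k \<le> n"
  shows "q_factor r n = q_factor r k * (\<Prod>j\<in>{k<..n}. 1 - r ^ j)"
proof -
  have "{1..n} = {1..k} \<union> {k<..n}" using assms by auto
  then show ?thesis
    unfolding q_factor_def by (simp only:) (rule prod.union_disjoint, auto)
qed

text \<open>Division by \<open>q_factor\<close> absorbs the product over k < j. The added term k =
  n, moved to the left, gives the factor 1 - r^n, which cancels the last factor of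
  \<open>q_factor r n\<close>.\<close>

lemma normalized_recurrence:
  fixes t r :: "'a :: field"
  assumes r: "\<And>j. j > 0 \<Longrightarrow> r ^ j \<noteq> 1"
  defines "B \<equiv> \<lambda>n. inv_maj_poly n t r / q_factor r n"
  shows "B n = (\<Sum>k\<le>n. r ^ k * gauss_binomial t n k * B k)"
proof (cases n)
  case 0
  then show ?thesis by simp
next
  case (Suc l)
  have nz: "q_factor r k \<noteq> 0" for k
    using r by (auto simp: q_factor_eq_0_iff)
  have "(1 - r ^ n) * B n = inv_maj_poly n t r / q_factor r l"
    using nz[of n] by (simp add: B_def Suc q_factor_Suc)
  also have "\<dots> = (\<Sum>k\<le>l. r ^ k * gauss_binomial t n k * B k)"
    unfolding Suc inv_maj_poly_recurrence sum_divide_distrib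
  proof (intro sum.cong refl)
    fix k assume "k \<in> {..l}"
    then have q: "q_factor r l = q_factor r k * (\<Prod>j\<in>{k<..l}. 1 - r ^ j)"
      by (intro q_factor_split) auto
    with nz[of l] have "(\<Prod>j\<in>{k<..l}. 1 - r ^ j) \<noteq> 0" by auto
    then show "r ^ k * (\<Prod>j\<in>{k<..l}. 1 - r ^ j) * (gauss_binomial t (Suc l) k * inv_maj_poly k t r) / q_factor r l
        = r ^ k * gauss_binomial t (Suc l) k * B k"
      unfolding q B_def by (simp add: field_simps)
  qed
  finally show ?thesis by (simp add: Suc algebra_simps)
qed

lemma sum_mod_blocks:
  fixes f :: "nat \<Rightarrow> 'a :: comm_monoid_add"
  shows "(\<Sum>a\<le>k. \<Sum>b<m. f (m * a + b)) = (\<Sum>c<m * Suc k. f c)"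
proof (induction k)
  case (Suc k)
  have "(\<Sum>c<N + m. f c) = (\<Sum>c<N. f c) + (\<Sum>b<m. f (N + b))" for N
    by (induction m) (simp_all add: add.assoc)
  from this[of "m * Suc k"] show ?case using Suc by (simp add: ac_simps)
qed simp

lemma inv_maj_poly_root_of_unity:
  fixes t r :: "'a :: field"
  assumes prim: "primitive_root_of_unity m t" and r: "\<And>j. j > 0 \<Longrightarrow> r ^ j \<noteq> 1" and "i < m"
  shows "inv_maj_poly (m * k + i) t r / q_factor r (m * k + i) =
         inv_maj_poly i t r / q_factor r i / (1 - r ^ m) ^ k"
proof -
  define B where "B n = inv_maj_poly n t r / q_factor r n" for n
  define G where "G = gauss_binomial t"
  \<comment> \<open>The claimed value is extended to every index through quotient and remainder
    modulo m, so that it can be tested against the whole recurrence.\<close>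
  define C where "C n = B (n mod m) / (1 - r ^ m) ^ (n div m)" for n
  have m: "m > 0" using \<open>i < m\<close> by simp
  have B_rec: "B n = (\<Sum>c\<le>n. r ^ c * G n c * B c)" for n
    unfolding B_def G_def by (rule normalized_recurrence[OF r])
  \<comment> \<open>Coefficients with c > n vanish, so the sum can be padded to complete blocks of
    length m.\<close>
  have ext: "(\<Sum>c\<le>n. r ^ c * G n c * f c) = (\<Sum>c<N. r ^ c * G n c * f c)" if "n < N" for n N f
    by (rule sum.mono_neutral_left) (use that in \<open>auto simp: G_def gauss_binomial_eq_0\<close>)
  have C_rec: "C n = (\<Sum>c\<le>n. r ^ c * G n c * C c)" for n
  proof -
    define k i where "k = n div m" and "i = n mod m"
    have n: "n = m * k + i" and i: "i < m" using m by (auto simp: k_def i_def)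
    have y: "1 - r ^ m \<noteq> 0" using r[OF m] by simp
    have "(\<Sum>c\<le>n. r ^ c * G n c * C c) = (\<Sum>c<m * Suc k. r ^ c * G n c * C c)"
      using i by (intro ext) (simp add: n)
    also have "\<dots> = (\<Sum>a\<le>k. \<Sum>b<m. r ^ (m * a + b) * G n (m * a + b) * C (m * a + b))"
      using sum_mod_blocks[where m = m and k = k and f = "\<lambda>c. r ^ c * G n c * C c"] by simp
    \<comment> \<open>By q-Lucas each summand separates into a factor in a and a factor in
      b.\<close>
    also have "\<dots> = (\<Sum>a\<le>k. \<Sum>b<m. (of_nat (k choose a) * (r ^ m / (1 - r ^ m)) ^ a) * (r ^ b * G i b * B b))"
    proof (intro sum.cong refl)
      fix a b assume "b \<in> {..<m}"
      then have "G n (m * a + b) = of_nat (k choose a) * G i b" "C (m * a + b) = B b / (1 - r ^ m) ^ a"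
        using gauss_binomial_lucas[OF prim i, of b k a] by (simp_all add: G_def n C_def)
      then show "r ^ (m * a + b) * G n (m * a + b) * C (m * a + b) =
          (of_nat (k choose a) * (r ^ m / (1 - r ^ m)) ^ a) * (r ^ b * G i b * B b)"
        by (simp add: power_add power_mult power_divide)
    qed
    also have "\<dots> = (\<Sum>a\<le>k. of_nat (k choose a) * (r ^ m / (1 - r ^ m)) ^ a) * (\<Sum>b<m. r ^ b * G i b * B b)"
      by (simp add: sum_product)
    \<comment> \<open>The inner sum is the padded recurrence for \<open>B i\<close>; the outer one
      is a binomial expansion.\<close>
    also have "(\<Sum>b<m. r ^ b * G i b * B b) = B i"
      using B_rec[of i] ext[OF i, of B] by simp
    also have "(\<Sum>a\<le>k. of_nat (k choose a) * (r ^ m / (1 - r ^ m)) ^ a) = (r ^ m / (1 - r ^ m) + 1) ^ k"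
      by (simp add: binomial_ring)
    also have "r ^ m / (1 - r ^ m) + 1 = 1 / (1 - r ^ m)"
      using y by (simp add: field_simps)
    finally show ?thesis
      by (simp add: C_def power_divide flip: k_def i_def)
  qed
  have "B n = C n" for n
  proof (induction n rule: less_induct)
    case (less n)
    show ?case
    proof (cases "n = 0")
      \<comment> \<open>At index 0 the recurrence is a tautology, so agreement comes from the
        definition of \<open>C\<close>.\<close>
      case True
      then show ?thesis by (simp add: C_def)
    next
      case False
      \<comment> \<open>Isolating the top term leaves only earlier values and the factor 1 - r^n,
        which is nonzero for n > 0.\<close>
      have split: "(\<Sum>c\<le>n. r ^ c * G n c * f c) = (\<Sum>c<n. r ^ c * G n c * f c) + r ^ n * f n" for f
        by (simp add: G_def flip: lessThan_Suc_atMost)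
      have "(1 - r ^ n) * B n = (\<Sum>c<n. r ^ c * G n c * B c)"
        using B_rec[of n] split[of B] by (simp add: algebra_simps)
      also have "\<dots> = (\<Sum>c<n. r ^ c * G n c * C c)"
        using less by simp
      also have "\<dots> = (1 - r ^ n) * C n"
        using C_rec[of n] split[of C] by (simp add: algebra_simps)
      finally show ?thesis using r[of n] False by simp
    qed
  qed
  from this[of "m * k + i"] show ?thesis
    using \<open>i < m\<close> by (simp add: B_def C_def)
qed

section \<open>Passage to rational functions\<close>

lemma ratfun_const_power: "ratfun_const c ^ j = ratfun_const (c ^ j)"
  by (induction j) (simp_all add: ratfun_const_def flip: one_pCons to_fract_mult)

lemma ratfun_const_eq_1_iff: "ratfun_const c = 1 \<longleftrightarrow> c = 1"
  by (simp add: ratfun_const_def one_pCons flip: to_fract_1)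

text \<open>The embedding of constants is multiplicative and sends only 1 to 1, so it preserves
  exact orders.\<close>

lemma primitive_root_of_unity_ratfun_const:
  "primitive_root_of_unity m (ratfun_const \<zeta>) \<longleftrightarrow> primitive_root_of_unity m \<zeta>"
  by (simp add: primitive_root_of_unity_def ratfun_const_power ratfun_const_eq_1_iff)

lemma ratfun_X_power_neq_1:
  assumes "j > 0"
  shows "ratfun_X ^ j \<noteq> 1"
proof
  have "ratfun_X ^ j = to_fract ([:0, 1:] ^ j)"
    by (induction j) (simp_all add: ratfun_X_def flip: to_fract_mult)
  moreover assume "ratfun_X ^ j = 1"
  ultimately have "[:0, 1:] ^ j = (1 :: complex poly)"
    by (simp flip: to_fract_1)
  \<comment> \<open>Evaluation at 0 separates a positive power of the indeterminate from 1.\<close>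
  then have "poly ([:0, 1:] ^ j) 0 = (1 :: complex)" by simp
  with assms show False by (simp add: poly_power zero_power)
qed

theorem theorem4p4:
  fixes n m k i :: nat and \<zeta> :: complex
  assumes "n > 0" and "m > 0"
    and "primitive_root_of_unity m \<zeta>"
    and "n = m * k + i" and "i < m"
  shows "inv_maj_poly n (ratfun_const \<zeta>) ratfun_X =
    inv_maj_poly i (ratfun_const \<zeta>) ratfun_X *
      (q_factor ratfun_X n / (q_factor ratfun_X i * (1 - ratfun_X ^ m) ^ k))"
proof -
  have "q_factor ratfun_X n \<noteq> 0"
    by (auto simp: q_factor_eq_0_iff ratfun_X_power_neq_1)
  moreover have "inv_maj_poly n (ratfun_const \<zeta>) ratfun_X / q_factor ratfun_X n =
      inv_maj_poly i (ratfun_const \<zeta>) ratfun_X / q_factor ratfun_X i / (1 - ratfun_X ^ m) ^ k"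
    unfolding assms(4) using assms(3,5)
    by (intro inv_maj_poly_root_of_unity ratfun_X_power_neq_1)
       (simp_all add: primitive_root_of_unity_ratfun_const)
  ultimately show ?thesis
    by (simp add: divide_eq_eq)
qed

end
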